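(* Let $d,\ell,n$ be positive integers with $n\geqslant\ell\geqslant 2d$, let $0<\beta\leqslant1$, and let $\boldsymbol{X}$ be a $d$-dimensional random array on $[n]$ which is $(\beta,\ell)$-dissociated and whose entries take values in a measurable space $\mathcal{X}$. Then for every $1<p\leqslant2$, every measurable $f\colon\mathcal{X}^{\binom{[n]}{d}}\to\mathbb{R}$ with $f(\boldsymbol{X})\in L_p$, every integer $k$ with $d\leqslant k\leqslant\lfloor\ell/2\rfloor$, and every $I\in\binom{[n]}{\ell}$, there exists $J\in\binom{I}{k}$ such that for every $1\leqslant r<p$, \[ \big\|\mathbb{E}[f(\boldsymbol{X})\,|\,\mathcal{F}_J]-\mathbb{E}[f(\boldsymbol{X})]\big\|_{L_r}\leqslant\Big((p-1)^{-1/2}\sqrt{\frac{2k}{\ell}}+10\,\beta^{\frac1r-\frac1p}\Big)\big\|f(\boldsymbol{X})-\mathbb{E}[f(\boldsymbol{X})]\big\|_{L_p}. \] Moreover, if $I$ is an interval of $[n]$, then $J$ can be taken to be an interval too.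
   Context: $[n]=\{1,\dots,n\}$, $\binom{I}{d}$ is the set of $d$-element subsets of $I$. A $d$-dimensional random array on $[n]$ is a stochastic process $\boldsymbol{X}=\langle X_s:s\in\binom{[n]}{d}\rangle$; for $J\subseteq[n]$ with $|J|\geqslant d$, $\mathcal{F}_J=\sigma(\{X_s:s\in\binom{J}{d}\})$. For $n\geqslant\ell\geqslant2d$ and $0\leqslant\beta\leqslant1$, $\boldsymbol{X}$ is $(\beta,\ell)$-dissociated if for every $J,K\subseteq[n]$ with $|J|,|K|\geqslant d$, $|J|+|K|\leqslant\ell$ and $\max(J)<\min(K)$, and all events $A\in\mathcal{F}_J$, $B\in\mathcal{F}_K$, we have $|\mathbb{P}(A\cap B)-\mathbb{P}(A)\mathbb{P}(B)|\leqslant\beta$. An interval is a set of consecutive integers. *)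

theory Defs
  imports "HOL-Probability.Probability"
begin

definition subsets_of_card :: "nat set \<Rightarrow> nat \<Rightarrow> nat set set" where
  "subsets_of_card I d = {s. s \<subseteq> I \<and> card s = d}"

definition array_sigma ::
  "'a measure \<Rightarrow> 'b measure \<Rightarrow> nat \<Rightarrow> (nat set \<Rightarrow> 'a \<Rightarrow> 'b) \<Rightarrow> nat set \<Rightarrow> 'a measure" where
  "array_sigma M S d X J =
     sigma (space M) (\<Union>s\<in>subsets_of_card J d. {X s -` A \<inter> space M | A. A \<in> sets S})"

definition dissociated ::
  "'a measure \<Rightarrow> 'b measure \<Rightarrow> nat \<Rightarrow> nat \<Rightarrow> (nat set \<Rightarrow> 'a \<Rightarrow> 'b) \<Rightarrow> real \<Rightarrow> nat \<Rightarrow> bool" where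
  "dissociated M S n d X \<beta> l \<longleftrightarrow>
     (\<forall>J K. J \<subseteq> {1..n} \<longrightarrow> K \<subseteq> {1..n} \<longrightarrow> card J \<ge> d \<longrightarrow> card K \<ge> d \<longrightarrow>
        card J + card K \<le> l \<longrightarrow> J \<noteq> {} \<longrightarrow> K \<noteq> {} \<longrightarrow> Max J < Min K \<longrightarrow>
        (\<forall>A\<in>sets (array_sigma M S d X J). \<forall>B\<in>sets (array_sigma M S d X K).
           \<bar>measure M (A \<inter> B) - measure M A * measure M B\<bar> \<le> \<beta>))"

definition Lnorm :: "'a measure \<Rightarrow> real \<Rightarrow> ('a \<Rightarrow> real) \<Rightarrow> real" where
  "Lnorm M r g = (LINT x|M. \<bar>g x\<bar> powr r) powr (1 / r)"

definition nat_interval :: "nat set \<Rightarrow> bool" where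
  "nat_interval J \<longleftrightarrow> (\<forall>a\<in>J. \<forall>b\<in>J. \<forall>c. a \<le> c \<and> c \<le> b \<longrightarrow> c \<in> J)"

end

theory Submission
  imports Defs
begin

text \<open>
  Cut \<open>I\<close> into \<open>m = \<lfloor>l/k\<rfloor>\<close> consecutive blocks of size \<open>k\<close>, so that \<open>1/m \<le> 2k/l\<close>, and consider the
  martingale of conditional expectations of \<open>f(X)\<close> along the unions of initial blocks. In \<open>L\<^sub>p\<close> with
  \<open>1 < p \<le> 2\<close> its differences satisfy \<open>(p - 1) \<Sum> \<parallel>D\<^sub>i\<parallel>\<^sup>2 \<le> \<parallel>f\<parallel>\<^sup>2\<close> (Ricard and Xu), hence one of them is at
  most \<open>(p - 1)\<^sup>-\<^sup>1\<^sup>/\<^sup>2 m\<^sup>-\<^sup>1\<^sup>/\<^sup>2 \<parallel>f\<parallel>\<close>. Let \<open>J\<close> be the block added at that step. Conditioning that difference on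
  \<open>J\<close> leaves the conditional expectation of \<open>f(X)\<close> given \<open>J\<close>, up to the conditional expectation given
  \<open>J\<close> of a variable depending only on the preceding blocks. By dissociation the latter is nearly
  constant, as a truncation at level \<open>\<parallel>f\<parallel> \<beta>\<^sup>-\<^sup>1\<^sup>/\<^sup>p\<close> shows.
\<close>

subsection \<open>Inequalities for real powers\<close>

lemma convex_on_abs_powr:
  fixes p :: real
  assumes "1 \<le> p"
  shows "convex_on UNIV (\<lambda>x::real. \<bar>x\<bar> powr p)"
proof (rule convex_onI)
  fix t x y :: real
  assume t: "0 < t" "t < 1"
  \<comment> \<open>With one endpoint at 0 the claim reduces to this scaling,
    \<open>s powr p \<le> s\<close>; with both nonzero it is convexity on the positive
    half-line.\<close>
  have scale: "(s * a) powr p \<le> s * a powr p" if "0 < s" "s < 1" for s a :: real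
    using powr_le_one_le[of s p] that assms by (simp add: powr_mult mult_right_mono)
  have "((1 - t) * \<bar>x\<bar> + t * \<bar>y\<bar>) powr p \<le> (1 - t) * \<bar>x\<bar> powr p + t * \<bar>y\<bar> powr p"
  proof (cases "x = 0 \<or> y = 0")
    case True
    then show ?thesis using scale[of t "\<bar>y\<bar>"] scale[of "1 - t" "\<bar>x\<bar>"] t by auto
  next
    case False
    then show ?thesis using convex_onD[OF powr_convex[OF assms], of t "\<bar>x\<bar>" "\<bar>y\<bar>"] t by simp
  qed
  moreover have "\<bar>(1 - t) * x + t * y\<bar> \<le> (1 - t) * \<bar>x\<bar> + t * \<bar>y\<bar>"
    using t abs_triangle_ineq[of "(1 - t) * x" "t * y"] by (simp add: abs_mult)
  ultimately show "\<bar>(1 - t) *\<^sub>R x + t *\<^sub>R y\<bar> powr p \<le> (1 - t) * \<bar>x\<bar> powr p + t * \<bar>y\<bar> powr p"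
    using powr_mono2[of p "\<bar>(1 - t) * x + t * y\<bar>" "(1 - t) * \<bar>x\<bar> + t * \<bar>y\<bar>"] assms by simp
qed simp

text \<open>Convexity at the points \<open>x / t\<close> and \<open>y / (1 - t)\<close>. The weight
  stays free: \<open>t = 1/2\<close> gives closure of L_p under addition, and a weight proportional
  to the norms gives Minkowski's inequality.\<close>

lemma abs_add_powr_le:
  fixes p x y t :: real
  assumes "1 \<le> p" "0 < t" "t < 1"
  shows "\<bar>x + y\<bar> powr p \<le> t powr (1 - p) * \<bar>x\<bar> powr p + (1 - t) powr (1 - p) * \<bar>y\<bar> powr p"
proof -
  have "\<bar>t * (x / t) + (1 - t) * (y / (1 - t))\<bar> powr p
      \<le> t * \<bar>x / t\<bar> powr p + (1 - t) * \<bar>y / (1 - t)\<bar> powr p"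
    using convex_onD[OF convex_on_abs_powr[OF assms(1)], of "1 - t" "x / t" "y / (1 - t)"] assms by simp
  moreover have "s * \<bar>z / s\<bar> powr p = s powr (1 - p) * \<bar>z\<bar> powr p" if "0 < s" for s z :: real
    using that by (simp add: powr_divide powr_diff abs_divide)
  ultimately show ?thesis using assms by simp
qed

text \<open>Hoelder's inequality for two terms, by Young's inequality after normalizing
  \<open>u + v\<close> to 1. With q = p/2 it replaces Minkowski's inequality below exponent 1, where
  the direction reverses.\<close>

lemma add_powr_ge:
  fixes q u v t :: real
  assumes "0 < q" "q \<le> 1" "0 \<le> u" "0 \<le> v" "0 \<le> t" "t \<le> 1"
  shows "t powr (1 - q) * u powr q + (1 - t) powr (1 - q) * v powr q \<le> (u + v) powr q"
proof (cases "u + v = 0")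
  case False
  define w where "w = u + v"
  have w: "w > 0" using False assms by (simp add: w_def)
  have young: "s powr (1 - q) * z powr q \<le> (1 - q) * s + q * z" if "0 \<le> s" "0 \<le> z" for s z :: real
  proof (cases "s = 0 \<or> z = 0")
    case False
    then show ?thesis using Youngs_inequality_0[of "1 - q" q s z] that assms by simp
  qed (use that assms in auto)
  have "t powr (1 - q) * (u / w) powr q + (1 - t) powr (1 - q) * (v / w) powr q
      \<le> (1 - q) * t + q * (u / w) + ((1 - q) * (1 - t) + q * (v / w))"
    using young[of t "u / w"] young[of "1 - t" "v / w"] assms w by simp
  also have "\<dots> = 1 - q + q * ((u + v) / w)"
    by (simp add: algebra_simps add_divide_distrib)
  also have "\<dots> = 1" using w by (simp add: w_def)
  finally have "(t powr (1 - q) * u powr q + (1 - t) powr (1 - q) * v powr q) / w powr q \<le> 1"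
    by (simp add: powr_divide add_divide_distrib)
  then show ?thesis using w by (simp add: w_def)
qed (use assms in \<open>auto simp: add_nonneg_eq_0_iff\<close>)

text \<open>Bernoulli's inequality as the weighted AM-GM inequality for 1 + x and 1.\<close>

lemma powr_one_plus_le:
  fixes q x :: real
  assumes "0 \<le> q" "q \<le> 1" "0 \<le> x"
  shows "(1 + x) powr q \<le> 1 + q * x"
  using Youngs_inequality_0[of q "1 - q" "1 + x" 1] assms by (simp add: algebra_simps)

text \<open>Both sides agree at 0, and the derivatives compare by AM-GM: the two powers of exponent
  q - 1 sum to at least twice their geometric mean, a nonpositive power of 1 - s^2 and hence at
  least 1.\<close>

lemma powr_diff_ge:
  fixes q t :: real
  assumes "0 \<le> q" "q \<le> 1" "0 \<le> t" "t < 1"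
  shows "2 * q * t \<le> (1 + t) powr q - (1 - t) powr q"
proof -
  define h where "h = (\<lambda>s::real. (1 + s) powr q - (1 - s) powr q - 2 * q * s)"
  have "h 0 \<le> h t"
  proof (rule DERIV_nonneg_imp_nondecreasing[OF assms(3)])
    fix s assume s: "0 \<le> s" "s \<le> t"
    let ?a = "(1 + s) powr ((q - 1) / 2)" and ?b = "(1 - s) powr ((q - 1) / 2)"
    have "(h has_real_derivative q * (1 + s) powr (q - 1) + q * (1 - s) powr (q - 1) - 2 * q) (at s)"
      unfolding h_def using s assms(4) by (auto intro!: derivative_eq_intros)
    moreover have "2 \<le> (1 + s) powr (q - 1) + (1 - s) powr (q - 1)"
    proof -
      have "s * s < 1" using s assms(4) mult_strict_mono[of s 1 s 1] by simp
      then have "((1 + s) * (1 - s)) powr ((q - 1) / 2) \<ge> 1 powr ((q - 1) / 2)"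
        using assms by (intro powr_mono2') (auto simp: algebra_simps)
      then have "1 \<le> ?a * ?b" by (simp add: powr_mult)
      moreover have "0 \<le> (?a - ?b)\<^sup>2" by simp
      moreover have "?a\<^sup>2 = (1 + s) powr (q - 1)" "?b\<^sup>2 = (1 - s) powr (q - 1)"
        by (simp_all add: power2_eq_square flip: powr_add)
      ultimately show ?thesis by (simp add: power2_diff)
    qed
    then have "0 \<le> q * ((1 + s) powr (q - 1) + (1 - s) powr (q - 1) - 2)"
      using assms by simp
    ultimately show "\<exists>y. (h has_real_derivative y) (at s) \<and> 0 \<le> y"
      by (auto simp: algebra_simps)
  qed
  then show ?thesis by (simp add: h_def)
qed

text \<open>A global second-order Taylor bound at 0: differentiating once leaves p times the
  previous inequality for the exponent q = p - 1.\<close>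

lemma powr_sum_ge:
  fixes p t :: real
  assumes "1 < p" "p \<le> 2" "0 \<le> t" "t \<le> 1"
  shows "2 + p * (p - 1) * t\<^sup>2 \<le> (1 + t) powr p + (1 - t) powr p"
proof -
  define h where "h = (\<lambda>s::real. (1 + s) powr p + (1 - s) powr p - p * (p - 1) * s\<^sup>2)"
  have "h 0 \<le> h t"
  proof (rule DERIV_nonneg_imp_increasing_open[OF assms(3)])
    fix s assume s: "0 < s" "s < t"
    have "(h has_real_derivative p * (1 + s) powr (p - 1) - p * (1 - s) powr (p - 1) - p * (p - 1) * (2 * s)) (at s)"
      unfolding h_def using s assms(4) by (auto intro!: derivative_eq_intros)
    moreover have "0 \<le> p * ((1 + s) powr (p - 1) - (1 - s) powr (p - 1) - 2 * (p - 1) * s)"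
      using powr_diff_ge[of "p - 1" s] s assms by simp
    ultimately show "\<exists>y. (h has_real_derivative y) (at s) \<and> 0 \<le> y"
      by (auto simp: algebra_simps)
  \<comment> \<open>The derivative is taken only inside the interval, since the base 1 - s may
    vanish at the right end; continuity covers the endpoints.\<close>
  next
    show "continuous_on {0..t} h"
      unfolding h_def using assms by (intro continuous_intros continuous_on_powr') auto
  qed
  then show ?thesis by (simp add: h_def)
qed

text \<open>The Bonami--Gross--Beckner inequality, which carries the sharp constant \<open>p - 1\<close>.\<close>
lemma two_point_inequality:
  fixes a b p :: real
  assumes "1 < p" "p \<le> 2"
  shows "(a\<^sup>2 + (p - 1) * b\<^sup>2) powr (p / 2) \<le> (\<bar>a + b\<bar> powr p + \<bar>a - b\<bar> powr p) / 2"
proof -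
  \<comment> \<open>By homogeneity only t = b/a matters. Bernoulli bounds the left side by 1 + p(p -
    1)t^2/2, and the second-order bound places this below the right side.\<close>
  have le: "(a\<^sup>2 + (p - 1) * b\<^sup>2) powr (p / 2) \<le> (\<bar>a + b\<bar> powr p + \<bar>a - b\<bar> powr p) / 2"
    if "0 \<le> b" "b \<le> a" "0 < a" for a b :: real
  proof -
    define t where "t = b / a"
    have t: "0 \<le> t" "t \<le> 1" and b: "b = t * a" using that by (auto simp: t_def)
    have "a\<^sup>2 + (p - 1) * b\<^sup>2 = a\<^sup>2 * (1 + (p - 1) * t\<^sup>2)"
      by (simp add: b power_mult_distrib algebra_simps)
    moreover have "(a\<^sup>2) powr (p / 2) = a powr p"
      using that powr_powr[of a 2 "p / 2"] by simp
    ultimately have "(a\<^sup>2 + (p - 1) * b\<^sup>2) powr (p / 2) = a powr p * (1 + (p - 1) * t\<^sup>2) powr (p / 2)"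
      by (simp add: powr_mult)
    also have "\<dots> \<le> a powr p * (((1 + t) powr p + (1 - t) powr p) / 2)"
    proof (rule mult_left_mono)
      have "(1 + (p - 1) * t\<^sup>2) powr (p / 2) \<le> 1 + p / 2 * ((p - 1) * t\<^sup>2)"
        using assms by (intro powr_one_plus_le) auto
      then show "(1 + (p - 1) * t\<^sup>2) powr (p / 2) \<le> ((1 + t) powr p + (1 - t) powr p) / 2"
        using powr_sum_ge[OF assms t] by simp
    qed simp
    also have "\<dots> = (\<bar>a * (1 + t)\<bar> powr p + \<bar>a * (1 - t)\<bar> powr p) / 2"
      unfolding abs_mult powr_mult using t that by (simp add: distrib_left add_divide_distrib)
    also have "\<dots> = (\<bar>a + b\<bar> powr p + \<bar>a - b\<bar> powr p) / 2"
      by (simp add: b algebra_simps)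
    finally show ?thesis .
  qed
  \<comment> \<open>The right side is unchanged by signs and by swapping a and b. Putting the larger
    square first only increases the left side, because p - 1 \<le> 1.\<close>
  consider "a = 0" "b = 0" | "\<bar>b\<bar> \<le> \<bar>a\<bar>" "0 < \<bar>a\<bar>" | "\<bar>a\<bar> \<le> \<bar>b\<bar>" "0 < \<bar>b\<bar>" by linarith
  then show ?thesis
  proof cases
    case 1
    then show ?thesis by simp
  next
    case 2
    have "\<bar>\<bar>a\<bar> + \<bar>b\<bar>\<bar> = \<bar>a + b\<bar> \<and> \<bar>\<bar>a\<bar> - \<bar>b\<bar>\<bar> = \<bar>a - b\<bar>
        \<or> \<bar>\<bar>a\<bar> + \<bar>b\<bar>\<bar> = \<bar>a - b\<bar> \<and> \<bar>\<bar>a\<bar> - \<bar>b\<bar>\<bar> = \<bar>a + b\<bar>"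
      by (cases "0 \<le> a"; cases "0 \<le> b") (auto simp: abs_if)
    then have "\<bar>\<bar>a\<bar> + \<bar>b\<bar>\<bar> powr p + \<bar>\<bar>a\<bar> - \<bar>b\<bar>\<bar> powr p = \<bar>a + b\<bar> powr p + \<bar>a - b\<bar> powr p"
      by (metis add.commute)
    then show ?thesis using le[of "\<bar>b\<bar>" "\<bar>a\<bar>"] 2 by simp
  next
    case 3
    have "\<bar>\<bar>b\<bar> + \<bar>a\<bar>\<bar> = \<bar>a + b\<bar> \<and> \<bar>\<bar>b\<bar> - \<bar>a\<bar>\<bar> = \<bar>a - b\<bar>
        \<or> \<bar>\<bar>b\<bar> + \<bar>a\<bar>\<bar> = \<bar>a - b\<bar> \<and> \<bar>\<bar>b\<bar> - \<bar>a\<bar>\<bar> = \<bar>a + b\<bar>"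
      by (cases "0 \<le> a"; cases "0 \<le> b") (auto simp: abs_if)
    then have "\<bar>\<bar>b\<bar> + \<bar>a\<bar>\<bar> powr p + \<bar>\<bar>b\<bar> - \<bar>a\<bar>\<bar> powr p = \<bar>a + b\<bar> powr p + \<bar>a - b\<bar> powr p"
      by (metis add.commute)
    then have "(b\<^sup>2 + (p - 1) * a\<^sup>2) powr (p / 2) \<le> (\<bar>a + b\<bar> powr p + \<bar>a - b\<bar> powr p) / 2"
      using le[of "\<bar>a\<bar>" "\<bar>b\<bar>"] 3 by simp
    moreover have "a\<^sup>2 + (p - 1) * b\<^sup>2 \<le> b\<^sup>2 + (p - 1) * a\<^sup>2"
    proof -
      have "a\<^sup>2 \<le> b\<^sup>2" using 3 by (simp add: abs_le_square_iff)
      then have "0 \<le> (2 - p) * (b\<^sup>2 - a\<^sup>2)" using assms by simp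
      then show ?thesis by (simp add: algebra_simps)
    qed
    then have "(a\<^sup>2 + (p - 1) * b\<^sup>2) powr (p / 2) \<le> (b\<^sup>2 + (p - 1) * a\<^sup>2) powr (p / 2)"
      using assms by (intro powr_mono2) auto
    ultimately show ?thesis by linarith
  qed
qed

subsection \<open>Spaces of \<open>p\<close>-integrable functions\<close>

text \<open>Measurability is a separate demand because the power of \<open>\<bar>f x\<bar>\<close>
  forgets the sign of f. Integrability keeps \<open>Lnorm\<close> from taking the default value 0 of
  a divergent integral.\<close>

definition in_Lp :: "'a measure \<Rightarrow> real \<Rightarrow> ('a \<Rightarrow> real) \<Rightarrow> bool" where
  "in_Lp M p f \<longleftrightarrow> f \<in> borel_measurable M \<and> integrable M (\<lambda>x. \<bar>f x\<bar> powr p)"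

lemma in_LpD:
  assumes "in_Lp M p f"
  shows "f \<in> borel_measurable M" "integrable M (\<lambda>x. \<bar>f x\<bar> powr p)"
  using assms by (auto simp: in_Lp_def)

lemma in_Lp_bound:
  assumes "in_Lp M p g" "f \<in> borel_measurable M" "AE x in M. \<bar>f x\<bar> \<le> \<bar>g x\<bar>" "0 \<le> p"
  shows "in_Lp M p f"
  unfolding in_Lp_def
proof
  show "integrable M (\<lambda>x. \<bar>f x\<bar> powr p)"
    using in_LpD(2)[OF assms(1)] _ _
    by (rule Bochner_Integration.integrable_bound) (use assms in \<open>auto elim!: eventually_mono intro: powr_mono2\<close>)
qed fact

lemma in_Lp_cmult:
  assumes "in_Lp M p f"
  shows "in_Lp M p (\<lambda>x. c * f x)"
  using in_LpD[OF assms] by (simp add: in_Lp_def abs_mult powr_mult)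

lemma in_Lp_add:
  assumes "in_Lp M p f" "in_Lp M p g" "1 \<le> p"
  shows "in_Lp M p (\<lambda>x. f x + g x)"
  unfolding in_Lp_def
proof
  note [measurable] = in_LpD(1)[OF assms(1)] in_LpD(1)[OF assms(2)]
  show "(\<lambda>x. f x + g x) \<in> borel_measurable M" by simp
  have "integrable M (\<lambda>x. (1/2) powr (1 - p) * \<bar>f x\<bar> powr p + (1/2) powr (1 - p) * \<bar>g x\<bar> powr p)"
    using in_LpD(2)[OF assms(1)] in_LpD(2)[OF assms(2)] by simp
  then show "integrable M (\<lambda>x. \<bar>f x + g x\<bar> powr p)"
    by (rule Bochner_Integration.integrable_bound)
       (use abs_add_powr_le[of p "1/2"] assms in \<open>auto intro!: AE_I2\<close>)
qed

lemma in_Lp_diff: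
  assumes "in_Lp M p f" "in_Lp M p g" "1 \<le> p"
  shows "in_Lp M p (\<lambda>x. f x - g x)"
  using in_Lp_add[OF assms(1) in_Lp_cmult[OF assms(2), of "-1"] assms(3)] by simp

lemma Lnorm_nonneg [simp]: "0 \<le> Lnorm M p f"
  by (simp add: Lnorm_def)

lemma Lnorm_powr:
  assumes "0 < p"
  shows "Lnorm M p f powr p = (LINT x|M. \<bar>f x\<bar> powr p)"
  using assms by (simp add: Lnorm_def powr_powr)

lemma Lnorm_leI:
  assumes "0 < p" "0 \<le> c" "(LINT x|M. \<bar>f x\<bar> powr p) \<le> c powr p"
  shows "Lnorm M p f \<le> c"
  using powr_mono2[OF _ _ assms(3), of "1 / p"] assms by (simp add: Lnorm_def powr_powr)

lemma Lnorm_cong_AE: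
  assumes "f \<in> borel_measurable M" "g \<in> borel_measurable M" "AE x in M. f x = g x"
  shows "Lnorm M p f = Lnorm M p g"
proof -
  note [measurable] = assms(1,2)
  show ?thesis
    unfolding Lnorm_def
    by (rule arg_cong[where f="\<lambda>x. x powr (1 / p)"], rule integral_cong_AE) (use assms(3) in auto)
qed

lemma Lnorm_cmult:
  assumes "0 < p"
  shows "Lnorm M p (\<lambda>x. c * f x) = \<bar>c\<bar> * Lnorm M p f"
  using assms by (simp add: Lnorm_def abs_mult powr_mult powr_powr)

text \<open>Integrates the weighted convexity bound with weights proportional to the two norms. The
  slack e keeps both weights positive when a norm vanishes.\<close>

lemma Lnorm_triangle:
  assumes "in_Lp M p f" "in_Lp M p g" "1 \<le> p"
  shows "Lnorm M p (\<lambda>x. f x + g x) \<le> Lnorm M p f + Lnorm M p g"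
proof (rule field_le_epsilon)
  fix e :: real
  assume e: "0 < e"
  define a where "a = Lnorm M p f + e / 2"
  define b where "b = Lnorm M p g + e / 2"
  define t where "t = a / (a + b)"
  have a: "0 < a" and b: "0 < b"
    using e Lnorm_nonneg[of M p f] Lnorm_nonneg[of M p g] by (auto simp: a_def b_def add_nonneg_pos)
  have t: "0 < t" "t < 1" "1 - t = b / (a + b)" using a b by (auto simp: t_def field_simps)
  have "(LINT x|M. \<bar>f x + g x\<bar> powr p)
      \<le> (LINT x|M. t powr (1 - p) * \<bar>f x\<bar> powr p + (1 - t) powr (1 - p) * \<bar>g x\<bar> powr p)"
    using in_LpD[OF assms(1)] in_LpD[OF assms(2)] in_LpD[OF in_Lp_add[OF assms]]
    by (intro integral_mono abs_add_powr_le assms t) auto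
  also have "\<dots> = t powr (1 - p) * Lnorm M p f powr p + (1 - t) powr (1 - p) * Lnorm M p g powr p"
    using in_LpD[OF assms(1)] in_LpD[OF assms(2)] assms(3) by (simp add: Lnorm_powr)
  also have "\<dots> \<le> t powr (1 - p) * a powr p + (1 - t) powr (1 - p) * b powr p"
    using e assms(3) by (intro add_mono mult_left_mono powr_mono2) (auto simp: a_def b_def)
  also have "\<dots> = a * (a + b) powr (p - 1) + b * (a + b) powr (p - 1)"
    using a b unfolding t(3) by (simp add: t_def powr_divide powr_diff)
  also have "\<dots> = (a + b) powr p"
    using powr_mult_base[of "a + b" "p - 1"] a b by (simp flip: distrib_right)
  finally have "Lnorm M p (\<lambda>x. f x + g x) \<le> a + b"
    using a b assms(3) by (intro Lnorm_leI) auto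
  then show "Lnorm M p (\<lambda>x. f x + g x) \<le> Lnorm M p f + Lnorm M p g + e"
    by (simp add: a_def b_def)
qed

text \<open>The 2-uniform convexity of L_p with constant p - 1: the two-point inequality is applied
  pointwise and integrated. The squared norms are separated by a reverse Minkowski inequality for
  the exponent p/2.\<close>

lemma Lnorm_uniformly_convex:
  assumes "in_Lp M p f" "in_Lp M p g" "1 < p" "p \<le> 2"
  shows "2 * ((Lnorm M p f)\<^sup>2 + (p - 1) * (Lnorm M p g)\<^sup>2)
    \<le> (Lnorm M p (\<lambda>x. f x + g x))\<^sup>2 + (Lnorm M p (\<lambda>x. f x - g x))\<^sup>2"
proof (cases "(Lnorm M p f)\<^sup>2 + (p - 1) * (Lnorm M p g)\<^sup>2 = 0")
  case False
  define a where "a = (Lnorm M p f)\<^sup>2"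
  define b where "b = (p - 1) * (Lnorm M p g)\<^sup>2"
  define t where "t = a / (a + b)"
  have a: "0 \<le> a" and b: "0 \<le> b" and ab: "0 < a + b"
    using assms(3) False by (auto simp: a_def b_def less_le)
  have t: "0 \<le> t" "t \<le> 1" "1 - t = b / (a + b)" using a b ab by (auto simp: t_def field_simps)
  have pow: "(z\<^sup>2) powr (p / 2) = \<bar>z\<bar> powr p" for z :: real
    using powr_powr[of "\<bar>z\<bar>" 2 "p / 2"] by simp
  note int = in_LpD(2)[OF assms(1)] in_LpD(2)[OF assms(2)]
    in_LpD(2)[OF in_Lp_add[OF assms(1,2)]] in_LpD(2)[OF in_Lp_diff[OF assms(1,2)]]
  have nn: "s powr (1 - p / 2) * s powr (p / 2) = s" if "0 \<le> s" for s :: real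
    using that by (simp flip: powr_add)
  have split: "(c / (a + b)) powr (1 - p / 2) * c powr (p / 2) = c * (a + b) powr (p / 2 - 1)"
    if "0 \<le> c" for c
  proof -
    have "(a + b) powr (p / 2 - 1) = 1 / (a + b) powr (1 - p / 2)"
      using powr_minus_divide[of "a + b" "1 - p / 2"] by simp
    then have "(c / (a + b)) powr (1 - p / 2) * c powr (p / 2)
        = (c powr (1 - p / 2) * c powr (p / 2)) * (a + b) powr (p / 2 - 1)"
      by (simp add: powr_divide)
    then show ?thesis by (simp only: nn[OF that])
  qed
  \<comment> \<open>The weight \<open>t = a / (a + b)\<close> is the equality case of
    \<open>add_powr_ge\<close>, so nothing is lost in splitting the sum.\<close>
  have "(a + b) powr (p / 2) = t powr (1 - p / 2) * a powr (p / 2) + (1 - t) powr (1 - p / 2) * b powr (p / 2)"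
    unfolding t(3) using split[OF a] split[OF b] powr_mult_base[of "a + b" "p / 2 - 1"] ab
    by (simp add: t_def flip: distrib_right)
  also have "\<dots> = (LINT x|M. t powr (1 - p / 2) * ((f x)\<^sup>2) powr (p / 2)
        + (1 - t) powr (1 - p / 2) * ((p - 1) * (g x)\<^sup>2) powr (p / 2))"
    using int assms(3) by (simp add: a_def b_def powr_mult pow Lnorm_powr)
  also have "\<dots> \<le> (LINT x|M. (\<bar>f x + g x\<bar> powr p + \<bar>f x - g x\<bar> powr p) / 2)"
  proof (rule integral_mono)
    fix x
    have "t powr (1 - p / 2) * ((f x)\<^sup>2) powr (p / 2)
        + (1 - t) powr (1 - p / 2) * ((p - 1) * (g x)\<^sup>2) powr (p / 2)
        \<le> ((f x)\<^sup>2 + (p - 1) * (g x)\<^sup>2) powr (p / 2)"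
      using assms t by (intro add_powr_ge) auto
    also have "\<dots> \<le> (\<bar>f x + g x\<bar> powr p + \<bar>f x - g x\<bar> powr p) / 2"
      by (rule two_point_inequality[OF assms(3,4)])
    finally show "t powr (1 - p / 2) * ((f x)\<^sup>2) powr (p / 2)
        + (1 - t) powr (1 - p / 2) * ((p - 1) * (g x)\<^sup>2) powr (p / 2)
        \<le> (\<bar>f x + g x\<bar> powr p + \<bar>f x - g x\<bar> powr p) / 2" .
  qed (use int assms(3) in \<open>auto simp: pow powr_mult\<close>)
  also have "\<dots> = (Lnorm M p (\<lambda>x. f x + g x) powr p + Lnorm M p (\<lambda>x. f x - g x) powr p) / 2"
    using int assms(3) by (simp add: Lnorm_powr)
  finally have "((a + b) powr (p / 2)) powr (2 / p)
      \<le> ((Lnorm M p (\<lambda>x. f x + g x) powr p + Lnorm M p (\<lambda>x. f x - g x) powr p) / 2) powr (2 / p)"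
    using assms(3) by (intro powr_mono2) auto
  \<comment> \<open>As 2/p \<ge> 1, convexity bounds the power of the mean by the mean of the
    squared norms.\<close>
  also have "\<dots> \<le> ((Lnorm M p (\<lambda>x. f x + g x) powr p) powr (2 / p)
      + (Lnorm M p (\<lambda>x. f x - g x) powr p) powr (2 / p)) / 2"
    using convex_onD[OF convex_on_abs_powr[of "2 / p"], of "1 / 2"
      "Lnorm M p (\<lambda>x. f x + g x) powr p" "Lnorm M p (\<lambda>x. f x - g x) powr p"] assms
    by (simp add: add_divide_distrib)
  finally show ?thesis
    using assms(3) ab by (simp add: powr_powr a_def b_def)
qed simp

section \<open>Comparison of exponents and conditional expectation on a probability space\<close>

lemma (in prob_space) in_Lp_mono_exponent:
  assumes "in_Lp M p f" "1 \<le> r" "r \<le> p"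
  shows "in_Lp M r f"
  unfolding in_Lp_def
proof
  note [measurable] = in_LpD(1)[OF assms(1)]
  show "f \<in> borel_measurable M" by simp
  have "z powr r \<le> 1 + z powr p" if "0 \<le> z" for z :: real
  proof (cases "z \<le> 1")
    case True
    then show ?thesis using powr_le1[of r z] that assms by (auto intro: add_increasing2)
  next
    case False
    then show ?thesis using powr_mono[OF assms(3), of z] by linarith
  qed
  moreover have "integrable M (\<lambda>x. 1 + \<bar>f x\<bar> powr p)" using in_LpD(2)[OF assms(1)] by simp
  ultimately show "integrable M (\<lambda>x. \<bar>f x\<bar> powr r)"
    by (elim Bochner_Integration.integrable_bound) (auto intro!: AE_I2)
qed

lemma (in prob_space) in_Lp_imp_integrable:
  assumes "in_Lp M p f" "1 \<le> p"
  shows "integrable M f"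
  using in_LpD[OF in_Lp_mono_exponent[OF assms(1), of 1]] assms(2) integrable_abs_cancel by auto

text \<open>Normalize by c slightly above the p-norm, so that division is safe, and integrate
  Young's inequality between the p-th power and the constant 1.\<close>

lemma (in prob_space) Lnorm_mono_exponent:
  assumes "in_Lp M p f" "1 \<le> r" "r \<le> p"
  shows "Lnorm M r f \<le> Lnorm M p f"
proof (rule field_le_epsilon)
  fix e :: real
  assume e: "0 < e"
  define c where "c = Lnorm M p f + e"
  have c: "0 < c" using e by (auto simp: c_def intro: add_nonneg_pos)
  have young: "\<bar>z\<bar> powr r \<le> c powr r * (r / p * (\<bar>z\<bar> powr p / c powr p) + (1 - r / p))" for z
  proof (cases "z = 0")
    case False
    have "(\<bar>z / c\<bar> powr p) powr (r / p) * 1 powr (1 - r / p) \<le> r / p * \<bar>z / c\<bar> powr p + (1 - r / p) * 1"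
      using False c assms by (intro Youngs_inequality_0) auto
    then have "\<bar>z\<bar> powr r / c powr r \<le> r / p * (\<bar>z\<bar> powr p / c powr p) + (1 - r / p)"
      using assms c by (simp add: powr_powr powr_divide)
    then show ?thesis using c by (simp add: field_simps)
  qed (use assms in \<open>auto intro!: mult_nonneg_nonneg add_nonneg_nonneg\<close>)
  have "(LINT x|M. \<bar>f x\<bar> powr r)
      \<le> (LINT x|M. c powr r * (r / p * (\<bar>f x\<bar> powr p / c powr p) + (1 - r / p)))"
    using in_LpD[OF assms(1)] in_LpD[OF in_Lp_mono_exponent[OF assms]] young by (intro integral_mono) auto
  also have "\<dots> = c powr r * (r / p * (Lnorm M p f powr p / c powr p) + (1 - r / p))"
    using in_LpD[OF assms(1)] assms by (simp add: Lnorm_powr prob_space)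
  also have "\<dots> \<le> c powr r * (r / p * 1 + (1 - r / p))"
  proof -
    have "Lnorm M p f powr p / c powr p \<le> 1"
      using c e assms by (auto simp: c_def intro!: powr_mono2)
    then show ?thesis using assms by (intro mult_left_mono add_right_mono) auto
  qed
  finally show "Lnorm M r f \<le> Lnorm M p f + e"
    using c assms by (intro Lnorm_leI) (auto simp: c_def)
qed

lemma (in prob_space) sigma_finite_subalgebraI:
  assumes "subalgebra M F"
  shows "sigma_finite_subalgebra M F"
proof -
  interpret finite_measure_subalgebra M F by unfold_locales (rule assms)
  show ?thesis by unfold_locales
qed

text \<open>Conditional Jensen for the convex function \<open>\<bar>x\<bar> powr p\<close>,
  integrated.\<close>

lemma (in prob_space) cond_exp_Lp:
  assumes "in_Lp M p f" "1 \<le> p" "subalgebra M F"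
  shows "in_Lp M p (real_cond_exp M F f)" "Lnorm M p (real_cond_exp M F f) \<le> Lnorm M p f"
proof -
  interpret sigma_finite_subalgebra M F by (rule sigma_finite_subalgebraI[OF assms(3)])
  note int = in_Lp_imp_integrable[OF assms(1,2)] in_LpD(2)[OF assms(1)]
  note conv = convex_on_abs_powr[OF assms(2)]
  have q: "(\<lambda>x::real. \<bar>x\<bar> powr p) \<in> borel_measurable borel" by measurable
  have "integrable M (\<lambda>x. \<bar>real_cond_exp M F f x\<bar> powr p)"
    by (rule integrable_convex_cond_exp[where I=UNIV and q="\<lambda>x. \<bar>x\<bar> powr p", OF int(1) _ _ int(2) conv q]) auto
  then show Lp: "in_Lp M p (real_cond_exp M F f)" by (simp add: in_Lp_def)
  have "AE x in M. \<bar>real_cond_exp M F f x\<bar> powr p \<le> real_cond_exp M F (\<lambda>x. \<bar>f x\<bar> powr p) x"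
    by (rule real_cond_exp_jensens_inequality(2)[where I=UNIV and q="\<lambda>x. \<bar>x\<bar> powr p", OF int(1) _ _ int(2) conv q]) auto
  then have "(LINT x|M. \<bar>real_cond_exp M F f x\<bar> powr p) \<le> (LINT x|M. real_cond_exp M F (\<lambda>x. \<bar>f x\<bar> powr p) x)"
    using in_LpD(2)[OF Lp] real_cond_exp_int(1)[OF int(2)] by (intro integral_mono_AE)
  also have "\<dots> = Lnorm M p f powr p"
    using real_cond_exp_int(2)[OF int(2)] assms(2) by (simp add: Lnorm_powr)
  finally show "Lnorm M p (real_cond_exp M F f) \<le> Lnorm M p f"
    using assms(2) by (intro Lnorm_leI) auto
qed

subsection \<open>Martingale differences\<close>

text \<open>
  With \<open>u = \<E>(f | F)\<close> and \<open>y = f - u\<close>, uniform convexity at \<open>u + y/2\<close> in direction \<open>y/2\<close> bounds the gain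
  \<open>\<parallel>u + y\<parallel>\<^sup>2 - \<parallel>u\<parallel>\<^sup>2\<close> from below by twice the gain for \<open>y/2\<close> plus \<open>(p - 1) \<parallel>y\<parallel>\<^sup>2 / 2\<close>. The gain is nonnegative, since
  conditional expectation is a contraction, so iterating the halving yields the constant \<open>p - 1\<close>.
\<close>
lemma (in prob_space) cond_exp_Lp_two_convex:
  assumes "in_Lp M p f" "1 < p" "p \<le> 2" "subalgebra M F"
  shows "(Lnorm M p (real_cond_exp M F f))\<^sup>2 + (p - 1) * (Lnorm M p (\<lambda>x. f x - real_cond_exp M F f x))\<^sup>2
    \<le> (Lnorm M p f)\<^sup>2"
proof -
  interpret sigma_finite_subalgebra M F by (rule sigma_finite_subalgebraI[OF assms(4)])
  have p: "1 \<le> p" "0 < p" using assms(2) by auto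
  define u where "u = real_cond_exp M F f"
  have u: "in_Lp M p u" unfolding u_def by (rule cond_exp_Lp(1)[OF assms(1) p(1) assms(4)])
  have intf: "integrable M f" by (rule in_Lp_imp_integrable[OF assms(1) p(1)])
  have intu: "integrable M u" by (rule in_Lp_imp_integrable[OF u p(1)])
  have uF: "u \<in> borel_measurable F" unfolding u_def by simp
  \<comment> \<open>The constant reached after n halvings. The claim must hold for every y with
    vanishing conditional expectation, since the induction step applies it to y/2.\<close>
  have approx: "(Lnorm M p u)\<^sup>2 + (p - 1) * (1 - (1 / 2) ^ n) * (Lnorm M p y)\<^sup>2
      \<le> (Lnorm M p (\<lambda>x. u x + y x))\<^sup>2"
    if "in_Lp M p y" "AE x in M. real_cond_exp M F y x = 0" for n y
    using that
  proof (induction n arbitrary: y)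
    \<comment> \<open>Contraction alone: u is the conditional expectation of u + y.\<close>
    case 0
    have inty: "integrable M y" by (rule in_Lp_imp_integrable[OF 0(1) p(1)])
    note add = in_Lp_add[OF u 0(1) p(1)]
    have "AE x in M. real_cond_exp M F (\<lambda>x. u x + y x) x = u x"
      using real_cond_exp_add[OF intu inty] real_cond_exp_F_meas[OF intu uF] 0(2)
      by eventually_elim simp
    then have "Lnorm M p u = Lnorm M p (real_cond_exp M F (\<lambda>x. u x + y x))"
      using in_LpD(1)[OF u] by (intro Lnorm_cong_AE) auto
    also have "\<dots> \<le> Lnorm M p (\<lambda>x. u x + y x)"
      by (rule cond_exp_Lp(2)[OF add p(1) assms(4)])
    finally show ?case by (simp add: power_mono)
  next
    case (Suc n)
    define h where "h = (\<lambda>x. 1 / 2 * y x)"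
    have h: "in_Lp M p h" unfolding h_def by (rule in_Lp_cmult[OF Suc.prems(1)])
    have "AE x in M. real_cond_exp M F h x = 0"
      using real_cond_exp_cmult[OF in_Lp_imp_integrable[OF Suc.prems(1) p(1)], of "1 / 2"] Suc.prems(2)
      unfolding h_def by eventually_elim simp
    from Suc.IH[OF h this]
    have IH: "(Lnorm M p u)\<^sup>2 + (p - 1) * (1 - (1 / 2) ^ n) * (Lnorm M p h)\<^sup>2
      \<le> (Lnorm M p (\<lambda>x. u x + h x))\<^sup>2" .
    have "(\<lambda>x. u x + h x + h x) = (\<lambda>x. u x + y x)" "(\<lambda>x. u x + h x - h x) = u"
      by (auto simp: h_def)
    then have uc: "2 * ((Lnorm M p (\<lambda>x. u x + h x))\<^sup>2 + (p - 1) * (Lnorm M p h)\<^sup>2)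
        \<le> (Lnorm M p (\<lambda>x. u x + y x))\<^sup>2 + (Lnorm M p u)\<^sup>2"
      using Lnorm_uniformly_convex[OF in_Lp_add[OF u h p(1)] h assms(2,3)] by simp
    have hy: "(Lnorm M p y)\<^sup>2 = 4 * (Lnorm M p h)\<^sup>2"
      unfolding h_def Lnorm_cmult[OF p(2)] by (simp add: power2_eq_square)
    \<comment> \<open>The constants obey c' = (c + (p - 1))/2, starting from 0, with fixed point p -
      1.\<close>
    have split: "(p - 1) * (1 - (1 / 2) ^ Suc n) * (Lnorm M p y)\<^sup>2
        = 2 * ((p - 1) * (1 - (1 / 2) ^ n) * (Lnorm M p h)\<^sup>2) + 2 * ((p - 1) * (Lnorm M p h)\<^sup>2)"
      unfolding hy by (simp add: field_simps)
    from uc split IH show ?case by argo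
  qed
  define y where "y = (\<lambda>x. f x - u x)"
  have y: "in_Lp M p y" unfolding y_def by (rule in_Lp_diff[OF assms(1) u p(1)])
  have "AE x in M. real_cond_exp M F y x = 0"
    using real_cond_exp_diff[OF intf intu] real_cond_exp_F_meas[OF intu uF]
    unfolding y_def by eventually_elim (simp add: u_def)
  note bound = approx[OF y this]
  have "(\<lambda>n. (Lnorm M p u)\<^sup>2 + (p - 1) * (1 - (1 / 2) ^ n) * (Lnorm M p y)\<^sup>2)
      \<longlonglongrightarrow> (Lnorm M p u)\<^sup>2 + (p - 1) * (1 - 0) * (Lnorm M p y)\<^sup>2"
    by (intro tendsto_intros LIMSEQ_power_zero) auto
  then have "(Lnorm M p u)\<^sup>2 + (p - 1) * (1 - 0) * (Lnorm M p y)\<^sup>2 \<le> (Lnorm M p (\<lambda>x. u x + y x))\<^sup>2"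
    by (rule LIMSEQ_le_const2) (use bound in auto)
  then show ?thesis by (simp add: y_def u_def)
qed

text \<open>By the tower property each difference is what remains of \<open>u (Suc i)\<close> after
  conditioning on \<open>F i\<close>. The two-convexity inequalities for successive i then
  telescope.\<close>

lemma (in prob_space) martingale_difference_sum:
  assumes "in_Lp M p f" "1 < p" "p \<le> 2"
    and sub: "\<And>i. i \<le> m \<Longrightarrow> subalgebra M (F i)"
    and filt: "\<And>i. i < m \<Longrightarrow> subalgebra (F (Suc i)) (F i)"
  shows "(p - 1) * (\<Sum>i<m. (Lnorm M p (\<lambda>x. real_cond_exp M (F (Suc i)) f x - real_cond_exp M (F i) f x))\<^sup>2)
    \<le> (Lnorm M p f)\<^sup>2"
proof -
  have p: "1 \<le> p" using assms(2) by simp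
  note intf = in_Lp_imp_integrable[OF assms(1) p]
  define u where "u = (\<lambda>i. real_cond_exp M (F i) f)"
  define D where "D = (\<lambda>i. Lnorm M p (\<lambda>x. u (Suc i) x - u i x))"
  have u: "in_Lp M p (u i)" "Lnorm M p (u i) \<le> Lnorm M p f" if "i \<le> m" for i
    unfolding u_def using cond_exp_Lp[OF assms(1) p sub[OF that]] by auto
  have step: "(Lnorm M p (u i))\<^sup>2 + (p - 1) * (D i)\<^sup>2 \<le> (Lnorm M p (u (Suc i)))\<^sup>2" if "i < m" for i
  proof -
    have i: "i \<le> m" "Suc i \<le> m" using that by auto
    interpret sigma_finite_subalgebra M "F i" by (rule sigma_finite_subalgebraI[OF sub[OF i(1)]])
    have nest: "AE x in M. real_cond_exp M (F i) (u (Suc i)) x = u i x"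
      unfolding u_def by (rule real_cond_exp_nested_subalg[OF sub[OF i(2)] filt[OF that] intf])
    note [measurable] = in_LpD(1)[OF u(1)[OF i(1)]] in_LpD(1)[OF u(1)[OF i(2)]]
    have "Lnorm M p (real_cond_exp M (F i) (u (Suc i))) = Lnorm M p (u i)"
      using nest by (intro Lnorm_cong_AE) auto
    moreover have "Lnorm M p (\<lambda>x. u (Suc i) x - real_cond_exp M (F i) (u (Suc i)) x) = D i"
      unfolding D_def using nest by (intro Lnorm_cong_AE) auto
    ultimately show ?thesis
      using cond_exp_Lp_two_convex[OF u(1)[OF i(2)] assms(2,3) sub[OF i(1)]] by simp
  qed
  have "(p - 1) * (\<Sum>i<j. (D i)\<^sup>2) \<le> (Lnorm M p (u j))\<^sup>2" if "j \<le> m" for j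
    using that
  proof (induction j)
    case (Suc j)
    then show ?case using step[of j] by (simp add: distrib_left)
  qed simp
  from this[of m] have "(p - 1) * (\<Sum>i<m. (D i)\<^sup>2) \<le> (Lnorm M p (u m))\<^sup>2" by simp
  also have "\<dots> \<le> (Lnorm M p f)\<^sup>2" using u(2)[of m] by (intro power_mono) auto
  finally show ?thesis by (simp add: D_def u_def)
qed

text \<open>Pigeonhole on the sum of squares: m differences all equal to the claimed bound would
  already exhaust the total.\<close>

lemma (in prob_space) ex_small_martingale_difference:
  assumes "in_Lp M p f" "1 < p" "p \<le> 2" "0 < m"
    and sub: "\<And>i. i \<le> m \<Longrightarrow> subalgebra M (F i)"
    and filt: "\<And>i. i < m \<Longrightarrow> subalgebra (F (Suc i)) (F i)"
  shows "\<exists>i<m. Lnorm M p (\<lambda>x. real_cond_exp M (F (Suc i)) f x - real_cond_exp M (F i) f x)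
    \<le> (p - 1) powr (-1/2) * sqrt (1 / real m) * Lnorm M p f"
proof (rule ccontr)
  define D where "D = (\<lambda>i. Lnorm M p (\<lambda>x. real_cond_exp M (F (Suc i)) f x - real_cond_exp M (F i) f x))"
  define c where "c = (p - 1) powr (-1/2) * sqrt (1 / real m) * Lnorm M p f"
  assume "\<not> ?thesis"
  then have less: "c < D i" if "i < m" for i using that by (auto simp: D_def c_def not_le)
  have c: "0 \<le> c" by (simp add: c_def)
  have sq: "((p - 1) powr (-1/2))\<^sup>2 = 1 / (p - 1)"
    using assms(2) powr_minus_divide[of "p - 1" 1] by (simp add: power2_eq_square flip: powr_add)
  have "(Lnorm M p f)\<^sup>2 = (p - 1) * (\<Sum>i<m. c\<^sup>2)"
    using assms(2,4) unfolding c_def power_mult_distrib sq by simp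
  also have "\<dots> < (p - 1) * (\<Sum>i<m. (D i)\<^sup>2)"
    using assms(2,4) c less by (intro mult_strict_left_mono sum_strict_mono power_strict_mono) auto
  finally show False
    using martingale_difference_sum[where F=F and m=m, OF assms(1-3) sub filt] by (simp add: D_def)
qed

subsection \<open>Conditional expectations under mixing\<close>

text \<open>B is the event that the deviation is nonnegative, so
  \<open>2 * indicator B x - 1\<close> is its sign. This sign is G-measurable, hence g may replace
  its conditional expectation under the integral.\<close>

lemma (in prob_space) cond_exp_deviation_L1:
  assumes "integrable M g" "subalgebra M G"
  shows "\<exists>B\<in>sets G. (LINT x|M. \<bar>real_cond_exp M G g x - expectation g\<bar>)
    = (LINT x|M. (2 * indicator B x - 1) * g x) - expectation g * (LINT x|M. 2 * indicator B x - 1)"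
proof -
  interpret sigma_finite_subalgebra M G by (rule sigma_finite_subalgebraI[OF assms(2)])
  define h where "h = (\<lambda>x. real_cond_exp M G g x - expectation g)"
  have [measurable]: "h \<in> borel_measurable G" by (simp add: h_def)
  define B where "B = {x \<in> space G. 0 \<le> h x}"
  have B[measurable]: "B \<in> sets G" by (simp add: B_def)
  then have BM[measurable]: "B \<in> sets M" using assms(2) by (auto simp: subalgebra_def)
  define s :: "'a \<Rightarrow> real" where "s = (\<lambda>x. 2 * indicator B x - 1)"
  have [measurable]: "s \<in> borel_measurable G" by (simp add: s_def)
  have sM [measurable]: "s \<in> borel_measurable M" by (simp add: s_def)
  have s1: "\<bar>s x\<bar> \<le> 1" for x by (auto simp: s_def indicator_def)
  have ints: "integrable M s" by (rule integrable_const_bound[of _ 1]) (use s1 in auto)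
  have intsg: "integrable M (\<lambda>x. s x * g x)"
    by (rule Bochner_Integration.integrable_bound[OF assms(1)])
       (use s1 assms(1) in \<open>auto simp: abs_mult intro!: AE_I2 mult_left_le_one_le\<close>)
  have intse: "integrable M (\<lambda>x. s x * real_cond_exp M G g x)"
    by (rule real_cond_exp_intg(1)) (use intsg assms(1) in auto)
  have "(LINT x|M. \<bar>h x\<bar>) = (LINT x|M. s x * real_cond_exp M G g x - expectation g * s x)"
    using assms(2) by (intro Bochner_Integration.integral_cong)
      (auto simp: s_def B_def h_def subalgebra_def indicator_def)
  also have "\<dots> = (LINT x|M. s x * real_cond_exp M G g x) - expectation g * (LINT x|M. s x)"
    using intse ints by simp
  also have "(LINT x|M. s x * real_cond_exp M G g x) = (LINT x|M. s x * g x)"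
    by (rule real_cond_exp_intg(2)) (use intsg assms(1) in auto)
  finally show ?thesis using B unfolding h_def s_def by blast
qed

text \<open>The strong mixing (alpha-mixing) coefficient of the two sigma-algebras is at most
  \<beta>.\<close>

definition (in prob_space) mixing :: "'a measure \<Rightarrow> 'a measure \<Rightarrow> real \<Rightarrow> bool" where
  "mixing F G \<beta> \<longleftrightarrow> (\<forall>A\<in>sets F. \<forall>B\<in>sets G. \<bar>prob (A \<inter> B) - prob A * prob B\<bar> \<le> \<beta>)"

text \<open>
  Testing against the sign \<open>s\<close> of the deviation reduces the claim to the covariance of \<open>g\<close> and \<open>s\<close>;
  the same reduction applied to \<open>s\<close> and \<open>F\<close> leaves a covariance of two signs.
\<close>
lemma (in prob_space) mixing_bounded_L1:
  assumes "subalgebra M F" "subalgebra M G" "mixing F G \<beta>" "g \<in> borel_measurable F"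
    and bound: "\<And>x. \<bar>g x\<bar> \<le> T"
  shows "(LINT x|M. \<bar>real_cond_exp M G g x - expectation g\<bar>) \<le> 4 * T * \<beta>"
proof -
  interpret F: sigma_finite_subalgebra M F by (rule sigma_finite_subalgebraI[OF assms(1)])
  have T: "0 \<le> T" using bound[of undefined] by linarith
  have gM[measurable]: "g \<in> borel_measurable M" by (rule measurable_from_subalg[OF assms(1,4)])
  have intg: "integrable M g"
    by (rule integrable_const_bound[of _ T]) (use bound in auto)
  obtain B where B: "B \<in> sets G" and
    dev: "(LINT x|M. \<bar>real_cond_exp M G g x - expectation g\<bar>)
      = (LINT x|M. (2 * indicator B x - 1) * g x) - expectation g * (LINT x|M. 2 * indicator B x - 1)"
    using cond_exp_deviation_L1[OF intg assms(2)] by blast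
  have BM[measurable]: "B \<in> sets M" using assms(2) B by (auto simp: subalgebra_def)
  define s :: "'a \<Rightarrow> real" where "s = (\<lambda>x. 2 * indicator B x - 1)"
  have [measurable]: "s \<in> borel_measurable M" by (simp add: s_def)
  have ints: "integrable M s"
    by (rule integrable_const_bound[of _ 1]) (auto simp: s_def indicator_def)
  obtain A where A: "A \<in> sets F" and
    dev': "(LINT x|M. \<bar>real_cond_exp M F s x - expectation s\<bar>)
      = (LINT x|M. (2 * indicator A x - 1) * s x) - expectation s * (LINT x|M. 2 * indicator A x - 1)"
    using cond_exp_deviation_L1[OF ints assms(1)] by blast
  have AM[measurable]: "A \<in> sets M" using assms(1) A by (auto simp: subalgebra_def)
  have ind: "integrable M (indicator C :: 'a \<Rightarrow> real)" if "C \<in> sets M" for C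
    using that by (intro integrable_const_bound[of _ 1]) auto
  have intgs: "integrable M (\<lambda>x. g x * s x)"
    by (rule Bochner_Integration.integrable_bound[OF integrable_mult_right[OF ints, of T]])
       (use bound T in \<open>auto simp: abs_mult intro!: AE_I2 mult_right_mono\<close>)
  have intge: "integrable M (\<lambda>x. g x * real_cond_exp M F s x)"
    by (rule F.real_cond_exp_intg(1)) (use intgs assms in auto)
  have "(LINT x|M. \<bar>real_cond_exp M G g x - expectation g\<bar>)
      = (LINT x|M. g x * s x) - expectation g * expectation s"
    unfolding dev s_def by (simp add: mult.commute)
  \<comment> \<open>Now the F-measurability of g is used, to project s onto F.\<close>
  also have "(LINT x|M. g x * s x) = (LINT x|M. g x * real_cond_exp M F s x)"
    by (rule F.real_cond_exp_intg(2)[symmetric]) (use intgs assms in auto)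
  also have "\<dots> - expectation g * expectation s
      = (LINT x|M. g x * (real_cond_exp M F s x - expectation s))"
    using intge intg by (simp add: right_diff_distrib)
  also have "\<dots> \<le> (LINT x|M. T * \<bar>real_cond_exp M F s x - expectation s\<bar>)"
  proof (rule integral_mono)
    fix x
    have "g x * (real_cond_exp M F s x - expectation s) \<le> \<bar>g x\<bar> * \<bar>real_cond_exp M F s x - expectation s\<bar>"
      by (simp flip: abs_mult)
    also have "\<dots> \<le> T * \<bar>real_cond_exp M F s x - expectation s\<bar>"
      using bound by (intro mult_right_mono) auto
    finally show "g x * (real_cond_exp M F s x - expectation s) \<le> T * \<bar>real_cond_exp M F s x - expectation s\<bar>" .
  qed (use intge intg F.real_cond_exp_int(1)[OF ints] in \<open>auto simp: right_diff_distrib\<close>)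
  also have "\<dots> = T * (LINT x|M. \<bar>real_cond_exp M F s x - expectation s\<bar>)" by simp
  \<comment> \<open>The factor 4 arises because each sign is twice an indicator minus 1, and
    constants do not affect a covariance.\<close>
  also have "(LINT x|M. \<bar>real_cond_exp M F s x - expectation s\<bar>) = 4 * (prob (A \<inter> B) - prob A * prob B)"
  proof -
    have "(\<lambda>x. (2 * indicator A x - 1) * s x)
        = (\<lambda>x. 4 * indicator (A \<inter> B) x - 2 * indicator A x - 2 * indicator B x + 1 :: real)"
      by (auto simp: s_def indicator_def)
    then have E1: "(LINT x|M. (2 * indicator A x - 1) * s x) = 4 * prob (A \<inter> B) - 2 * prob A - 2 * prob B + 1"
      using ind[OF AM] ind[OF BM] ind[OF sets.Int[OF AM BM]] by (simp add: prob_space)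
    have E2: "(LINT x|M. 2 * indicator A x - 1) = 2 * prob A - 1" "expectation s = 2 * prob B - 1"
      using ind[OF AM] ind[OF BM] by (simp_all add: prob_space s_def)
    show ?thesis unfolding dev' unfolding E1 E2 by (simp add: algebra_simps)
  qed
  also have "T * (4 * (prob (A \<inter> B) - prob A * prob B)) \<le> T * (4 * \<beta>)"
    using assms(3) A B T unfolding mixing_def by (intro mult_left_mono) (auto dest!: bspec)
  finally show ?thesis by simp
qed

text \<open>Interpolation between the L_1 estimate and the almost sure bound 2T on the deviation:
  all but one power of the deviation is estimated by 2T.\<close>

lemma (in prob_space) mixing_bounded_Lp:
  assumes "subalgebra M F" "subalgebra M G" "mixing F G \<beta>" "g \<in> borel_measurable F"
    and bound: "\<And>x. \<bar>g x\<bar> \<le> T" and "1 \<le> r" "0 < \<beta>" "0 < T"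
  shows "in_Lp M r (\<lambda>x. real_cond_exp M G g x - expectation g)"
    "Lnorm M r (\<lambda>x. real_cond_exp M G g x - expectation g) \<le> 4 * T * \<beta> powr (1 / r)"
proof -
  interpret G: sigma_finite_subalgebra M G by (rule sigma_finite_subalgebraI[OF assms(2)])
  have gM[measurable]: "g \<in> borel_measurable M" by (rule measurable_from_subalg[OF assms(1,4)])
  have intg: "integrable M g"
    by (rule integrable_const_bound[of _ T]) (use bound in auto)
  define h where "h = (\<lambda>x. real_cond_exp M G g x - expectation g)"
  have inth: "integrable M h" using G.real_cond_exp_int(1)[OF intg] by (simp add: h_def)
  have [measurable]: "h \<in> borel_measurable M" by (simp add: h_def)
  have "- T \<le> expectation g"
    using integral_mono[OF _ intg, of "\<lambda>_. - T"] bound by (simp add: prob_space abs_le_iff minus_le_iff)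
  moreover have "expectation g \<le> T"
    using integral_mono[OF intg, of "\<lambda>_. T"] bound by (simp add: prob_space abs_le_iff)
  moreover have b: "- T \<le> g x" "g x \<le> T" for x using bound[of x] by auto
  have "AE x in M. - T \<le> real_cond_exp M G g x"
    by (rule G.real_cond_exp_ge_c[OF intg]) (use b in auto)
  moreover have "AE x in M. real_cond_exp M G g x \<le> T"
    by (rule G.real_cond_exp_le_c[OF intg]) (use b in auto)
  ultimately have hT: "AE x in M. \<bar>h x\<bar> \<le> 2 * T"
    by (auto simp: h_def)
  have hr: "AE x in M. \<bar>h x\<bar> powr r \<le> (2 * T) powr (r - 1) * \<bar>h x\<bar>"
    using hT
  proof eventually_elim
    case (elim x)
    have "\<bar>h x\<bar> powr r = \<bar>h x\<bar> powr (r - 1) * \<bar>h x\<bar>"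
      using powr_mult_base[of "\<bar>h x\<bar>" "r - 1"] by (simp add: mult.commute)
    also have "\<dots> \<le> (2 * T) powr (r - 1) * \<bar>h x\<bar>"
      using elim assms by (intro mult_right_mono powr_mono2) auto
    finally show ?case .
  qed
  have inthr: "integrable M (\<lambda>x. \<bar>h x\<bar> powr r)"
    by (rule Bochner_Integration.integrable_bound[of _ "\<lambda>x. (2 * T) powr (r - 1) * \<bar>h x\<bar>"])
       (use inth hr in auto)
  then show "in_Lp M r (\<lambda>x. real_cond_exp M G g x - expectation g)"
    by (simp add: in_Lp_def h_def)
  have "(LINT x|M. \<bar>h x\<bar> powr r) \<le> (LINT x|M. (2 * T) powr (r - 1) * \<bar>h x\<bar>)"
    using inthr inth hr by (intro integral_mono_AE) auto
  also have "\<dots> = (2 * T) powr (r - 1) * (LINT x|M. \<bar>h x\<bar>)" by simp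
  also have "\<dots> \<le> (2 * T) powr (r - 1) * (4 * T * \<beta>)"
    using mixing_bounded_L1[OF assms(1-4) bound] by (intro mult_left_mono) (auto simp: h_def)
  also have "\<dots> = 2 * (2 * T) powr r * \<beta>"
    using assms(8) powr_mult_base[of "2 * T" "r - 1"] by (simp add: algebra_simps)
  \<comment> \<open>Since r \<ge> 1, the leading 2 is enlarged to \<open>2 powr r\<close>, which
    makes the r-th root exact.\<close>
  also have "\<dots> \<le> 2 powr r * (2 * T) powr r * \<beta>"
    using powr_mono[OF assms(6), of 2] assms(7) by (intro mult_right_mono) auto
  also have "\<dots> = (4 * T * \<beta> powr (1 / r)) powr r"
  proof -
    have "2 powr r * (2 * T) powr r = (4 * T) powr r" by (simp flip: powr_mult)
    then show ?thesis using assms(6,7) by (simp add: powr_mult[of "4 * T"] powr_powr)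
  qed
  finally show "Lnorm M r (\<lambda>x. real_cond_exp M G g x - expectation g) \<le> 4 * T * \<beta> powr (1 / r)"
    using assms by (intro Lnorm_leI) (auto simp: h_def)
qed

text \<open>The conditional expectation and the mean cost one norm each. This crude bound serves the
  unbounded tail of a truncation.\<close>

lemma (in prob_space) cond_exp_minus_expectation_Lp:
  assumes "in_Lp M r g" "1 \<le> r" "subalgebra M G"
  shows "in_Lp M r (\<lambda>x. real_cond_exp M G g x - expectation g)"
    "Lnorm M r (\<lambda>x. real_cond_exp M G g x - expectation g) \<le> 2 * Lnorm M r g"
proof -
  note intg = in_Lp_imp_integrable[OF assms(1,2)]
  have c: "in_Lp M r (\<lambda>_. - expectation g)" by (simp add: in_Lp_def)
  note ce = cond_exp_Lp[OF assms]
  show "in_Lp M r (\<lambda>x. real_cond_exp M G g x - expectation g)"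
    using in_Lp_add[OF ce(1) c assms(2)] by simp
  have "Lnorm M r (\<lambda>x. real_cond_exp M G g x - expectation g)
      \<le> Lnorm M r (real_cond_exp M G g) + Lnorm M r (\<lambda>_. - expectation g)"
    using Lnorm_triangle[OF ce(1) c assms(2)] by simp
  also have "Lnorm M r (\<lambda>_. - expectation g) = \<bar>expectation g\<bar>"
    using assms(2) by (simp add: Lnorm_def prob_space powr_powr)
  also have "\<bar>expectation g\<bar> \<le> Lnorm M 1 g"
    using integral_abs_bound[of M g] by (simp add: Lnorm_def)
  also have "\<dots> \<le> Lnorm M r g" using Lnorm_mono_exponent[OF assms(1) _ assms(2)] by simp
  finally show "Lnorm M r (\<lambda>x. real_cond_exp M G g x - expectation g) \<le> 2 * Lnorm M r g"
    using ce(2) by simp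
qed

text \<open>Truncation at T: the bounded part contributes 4 by mixing and the tail 2 by contraction,
  both times the same power of \<beta>.\<close>

lemma (in prob_space) mixing_Lp:
  assumes "subalgebra M F" "subalgebra M G" "mixing F G \<beta>" "0 < \<beta>"
    and "in_Lp M p g" "g \<in> borel_measurable F" "1 \<le> r" "r < p"
  shows "Lnorm M r (\<lambda>x. real_cond_exp M G g x - expectation g)
    \<le> 6 * \<beta> powr (1 / r - 1 / p) * Lnorm M p g"
proof (rule field_le_epsilon)
  interpret G: sigma_finite_subalgebra M G by (rule sigma_finite_subalgebraI[OF assms(2)])
  fix e :: real
  assume e: "0 < e"
  define c where "c = \<beta> powr (1 / r - 1 / p)"
  have c: "0 < c" using assms(4) by (simp add: c_def)
  \<comment> \<open>The norm with slack: positive even if the norm is 0, and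
    \<open>6 * c * N\<close> exceeds the target by exactly e.\<close>
  define N where "N = Lnorm M p g + e / (6 * c)"
  have N: "0 < N" "Lnorm M p g \<le> N" using e c by (auto simp: N_def intro!: add_nonneg_pos)
  \<comment> \<open>This level balances the parts: \<open>T * \<beta> powr (1 / r)\<close> and the
    r-norm bound of the tail are both \<open>N * c\<close>.\<close>
  define T where "T = N * \<beta> powr (- (1 / p))"
  have T: "0 < T" using N assms(4) by (simp add: T_def)
  have r: "r \<le> p" "1 \<le> p" using assms by auto
  note [measurable] = assms(6)
  have gM[measurable]: "g \<in> borel_measurable M" by (rule in_LpD(1)[OF assms(5)])
  define g1 where "g1 = (\<lambda>x. if \<bar>g x\<bar> \<le> T then g x else 0)"
  define g2 where "g2 = (\<lambda>x. if \<bar>g x\<bar> \<le> T then 0 else g x)"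
  have g1F: "g1 \<in> borel_measurable F" by (simp add: g1_def)
  have [measurable]: "g1 \<in> borel_measurable M" "g2 \<in> borel_measurable M"
    by (auto simp: g1_def g2_def)
  have g1: "\<bar>g1 x\<bar> \<le> T" for x using T by (simp add: g1_def)
  have g12: "g = (\<lambda>x. g1 x + g2 x)" by (auto simp: g1_def g2_def)
  have int1: "integrable M g1" by (rule integrable_const_bound[of _ T]) (use g1 in auto)
  have Lp2: "in_Lp M p g2"
    by (rule in_Lp_bound[OF assms(5)]) (use r in \<open>auto simp: g2_def\<close>)
  have Lr2: "in_Lp M r g2" by (rule in_Lp_mono_exponent[OF Lp2 assms(7) r(1)])
  have int2: "integrable M g2" by (rule in_Lp_imp_integrable[OF Lr2 assms(7)])
  have tail: "Lnorm M r g2 \<le> N * c"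
  proof (rule Lnorm_leI)
    \<comment> \<open>A Markov-type bound: r - p is negative, so that power is largest at the
      threshold.\<close>
    have "\<bar>g2 x\<bar> powr r \<le> T powr (r - p) * \<bar>g x\<bar> powr p" for x
    proof (cases "\<bar>g x\<bar> \<le> T")
      case False
      have "\<bar>g x\<bar> powr r = \<bar>g x\<bar> powr (r - p) * \<bar>g x\<bar> powr p" by (simp flip: powr_add)
      also have "\<dots> \<le> T powr (r - p) * \<bar>g x\<bar> powr p"
        using False T r by (intro mult_right_mono powr_mono2') auto
      finally show ?thesis using False by (simp add: g2_def)
    qed (simp add: g2_def)
    then have "(LINT x|M. \<bar>g2 x\<bar> powr r) \<le> (LINT x|M. T powr (r - p) * \<bar>g x\<bar> powr p)"
      using in_LpD(2)[OF Lr2] in_LpD(2)[OF assms(5)] by (intro integral_mono) auto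
    also have "\<dots> = T powr (r - p) * Lnorm M p g powr p"
      using r by (simp add: Lnorm_powr)
    also have "\<dots> \<le> T powr (r - p) * N powr p"
      using N r by (intro mult_left_mono powr_mono2) auto
    also have "\<dots> = N powr r * \<beta> powr (1 - r / p)"
    proof -
      have "- (1 / p) * (r - p) = 1 - r / p" using r by (simp add: field_simps)
      then have "T powr (r - p) = N powr (r - p) * \<beta> powr (1 - r / p)"
        by (simp only: T_def powr_mult powr_powr)
      moreover have "N powr r = N powr (r - p) * N powr p" by (simp flip: powr_add)
      ultimately show ?thesis by simp
    qed
    also have "\<dots> = (N * c) powr r"
      using assms(7) by (simp add: c_def powr_mult powr_powr left_diff_distrib)
    finally show "(LINT x|M. \<bar>g2 x\<bar> powr r) \<le> (N * c) powr r" .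
  qed (use assms N c in auto)
  note b1 = mixing_bounded_Lp[OF assms(1-3) g1F g1 assms(7) assms(4) T]
  note b2 = cond_exp_minus_expectation_Lp[OF Lr2 assms(7) assms(2)]
  have "AE x in M. real_cond_exp M G g x - expectation g
      = (real_cond_exp M G g1 x - expectation g1) + (real_cond_exp M G g2 x - expectation g2)"
    using G.real_cond_exp_add[OF int1 int2]
    unfolding g12 by eventually_elim (simp add: int1 int2)
  then have "Lnorm M r (\<lambda>x. real_cond_exp M G g x - expectation g)
      = Lnorm M r (\<lambda>x. (real_cond_exp M G g1 x - expectation g1) + (real_cond_exp M G g2 x - expectation g2))"
    by (intro Lnorm_cong_AE) auto
  also have "\<dots> \<le> 4 * T * \<beta> powr (1 / r) + 2 * (N * c)"
    using Lnorm_triangle[OF b1(1) b2(1) assms(7)] b1(2) b2(2) tail by simp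
  also have "4 * T * \<beta> powr (1 / r) = 4 * (N * c)"
    by (simp add: T_def c_def flip: powr_add)
  also have "4 * (N * c) + 2 * (N * c) = 6 * c * Lnorm M p g + e"
    using c by (simp add: N_def field_simps)
  finally show "Lnorm M r (\<lambda>x. real_cond_exp M G g x - expectation g)
      \<le> 6 * \<beta> powr (1 / r - 1 / p) * Lnorm M p g + e"
    by (simp add: c_def)
qed

text \<open>K plays the initial segment including the new block, F the preceding blocks and G the
  new block. Conditioning on G splits the deviation of f into the image of the K-F difference,
  handled by contraction, and the deviation of E(f | F), handled by mixing.\<close>

lemma (in prob_space) cond_exp_le_martingale_difference:
  assumes "in_Lp M p f" "1 \<le> r" "r < p" "0 < \<beta>" "mixing F G \<beta>"
    and "subalgebra M K" "subalgebra K F" "subalgebra K G"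
  shows "Lnorm M r (\<lambda>x. real_cond_exp M G f x - expectation f)
    \<le> Lnorm M p (\<lambda>x. real_cond_exp M K f x - real_cond_exp M F f x)
      + 6 * \<beta> powr (1 / r - 1 / p) * Lnorm M p f"
proof -
  have subF: "subalgebra M F" and subG: "subalgebra M G"
    using assms(6-8) by (auto simp: subalgebra_def)
  interpret F: sigma_finite_subalgebra M F by (rule sigma_finite_subalgebraI[OF subF])
  interpret G: sigma_finite_subalgebra M G by (rule sigma_finite_subalgebraI[OF subG])
  have rp: "1 \<le> p" "r \<le> p" using assms by auto
  define g where "g = real_cond_exp M F f"
  define h where "h = real_cond_exp M K f"
  have g: "in_Lp M p g" "Lnorm M p g \<le> Lnorm M p f"
    unfolding g_def using cond_exp_Lp[OF assms(1) rp(1) subF] by auto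
  have h: "in_Lp M p h" unfolding h_def by (rule cond_exp_Lp(1)[OF assms(1) rp(1) assms(6)])
  note intf = in_Lp_imp_integrable[OF assms(1) rp(1)]
  note intg = in_Lp_imp_integrable[OF g(1) rp(1)]
  note inth = in_Lp_imp_integrable[OF h(1) rp(1)]
  have Eg: "expectation g = expectation f" unfolding g_def by (rule F.real_cond_exp_int(2)[OF intf])
  have gF: "g \<in> borel_measurable F" unfolding g_def by simp
  define D where "D = (\<lambda>x. h x - g x)"
  have D: "in_Lp M p D" unfolding D_def by (rule in_Lp_diff[OF h g(1) rp(1)])
  note Dr = in_Lp_mono_exponent[OF D assms(2) rp(2)]
  note gr = in_Lp_mono_exponent[OF g(1) assms(2) rp(2)]
  have "AE x in M. real_cond_exp M G f x - expectation f
      = real_cond_exp M G D x + (real_cond_exp M G g x - expectation g)"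
    using G.real_cond_exp_diff[OF inth intg] G.real_cond_exp_nested_subalg[OF assms(6,8) intf]
    unfolding D_def by eventually_elim (simp add: Eg h_def)
  then have "Lnorm M r (\<lambda>x. real_cond_exp M G f x - expectation f)
      = Lnorm M r (\<lambda>x. real_cond_exp M G D x + (real_cond_exp M G g x - expectation g))"
    by (intro Lnorm_cong_AE) auto
  also have "\<dots> \<le> Lnorm M r (real_cond_exp M G D) + Lnorm M r (\<lambda>x. real_cond_exp M G g x - expectation g)"
    by (rule Lnorm_triangle[OF cond_exp_Lp(1)[OF Dr assms(2) subG]
          cond_exp_minus_expectation_Lp(1)[OF gr assms(2) subG] assms(2)])
  also have "\<dots> \<le> Lnorm M p D + 6 * \<beta> powr (1 / r - 1 / p) * Lnorm M p f"
  proof (rule add_mono)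
    show "Lnorm M r (real_cond_exp M G D) \<le> Lnorm M p D"
      using cond_exp_Lp(2)[OF Dr assms(2) subG] Lnorm_mono_exponent[OF D assms(2) rp(2)] by simp
    have "Lnorm M r (\<lambda>x. real_cond_exp M G g x - expectation g)
        \<le> 6 * \<beta> powr (1 / r - 1 / p) * Lnorm M p g"
      by (rule mixing_Lp[OF subF subG assms(5,4) g(1) gF assms(2,3)])
    also have "\<dots> \<le> 6 * \<beta> powr (1 / r - 1 / p) * Lnorm M p f"
      using g(2) by (intro mult_left_mono) auto
    finally show "Lnorm M r (\<lambda>x. real_cond_exp M G g x - expectation g)
        \<le> 6 * \<beta> powr (1 / r - 1 / p) * Lnorm M p f" .
  qed
  finally show ?thesis by (simp add: D_def h_def g_def)
qed

subsection \<open>Random arrays\<close>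

lemma space_array_sigma [simp]: "space (array_sigma M S d X J) = space M"
  unfolding array_sigma_def by (subst space_measure_of) auto

lemma sets_array_sigma:
  "sets (array_sigma M S d X J)
    = sigma_sets (space M) (\<Union>s\<in>subsets_of_card J d. {X s -` A \<inter> space M | A. A \<in> sets S})"
  unfolding array_sigma_def by (subst sets_measure_of) auto

lemma subsets_of_card_mono: "J \<subseteq> K \<Longrightarrow> subsets_of_card J d \<subseteq> subsets_of_card K d"
  by (auto simp: subsets_of_card_def)

lemma subalgebra_array_sigma:
  assumes "\<And>s. s \<in> subsets_of_card J d \<Longrightarrow> X s \<in> measurable M S"
  shows "subalgebra M (array_sigma M S d X J)"
  unfolding subalgebra_def sets_array_sigma
  using assms by (auto intro!: sets.sigma_sets_subset dest: measurable_sets)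

lemma subalgebra_array_sigma_mono:
  assumes "J \<subseteq> K"
  shows "subalgebra (array_sigma M S d X K) (array_sigma M S d X J)"
  unfolding subalgebra_def sets_array_sigma
  using subsets_of_card_mono[OF assms] by (auto intro!: sigma_sets_mono')

text \<open>For the first block, whose empty past is too small for the dissociation hypothesis.
  Since d \<ge> 1 the empty set has no d-subsets, and its sigma-algebra is trivial.\<close>

lemma (in prob_space) mixing_array_sigma_empty:
  assumes "1 \<le> d" "0 \<le> \<beta>" "subalgebra M G"
  shows "mixing (array_sigma M S d X {}) G \<beta>"
proof -
  have "subsets_of_card {} d = {}" using assms(1) by (auto simp: subsets_of_card_def)
  then have sets: "sets (array_sigma M S d X {}) = {{}, space M}"
    by (simp add: sets_array_sigma sigma_sets_empty_eq)
  have "space M \<inter> B = B" if "B \<in> sets G" for B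
    using assms(3) sets.sets_into_space[OF that] by (auto simp: subalgebra_def)
  then show ?thesis unfolding mixing_def sets using assms(2) by (auto simp: prob_space)
qed

text \<open>A point between two elements of the block belongs to the whole image, and monotonicity
  places its index between theirs.\<close>

lemma nat_interval_strict_mono_image:
  fixes e :: "nat \<Rightarrow> nat"
  assumes "nat_interval (e ` {..<l})" "strict_mono_on {..<l} e" "b \<le> l"
  shows "nat_interval (e ` {a..<b})"
  unfolding nat_interval_def
proof (intro ballI allI impI)
  fix u v c
  assume u: "u \<in> e ` {a..<b}" and v: "v \<in> e ` {a..<b}" and c: "u \<le> c \<and> c \<le> v"
  then obtain i j where i: "u = e i" "a \<le> i" "i < b" and j: "v = e j" "a \<le> j" "j < b" by auto
  have "u \<in> e ` {..<l}" "v \<in> e ` {..<l}" using i j assms(3) by auto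
  then have "c \<in> e ` {..<l}" using assms(1) c unfolding nat_interval_def by blast
  then obtain t where t: "c = e t" "t < l" by auto
  have "i \<le> t" "t \<le> j"
    using strict_mono_on_less_eq[OF assms(2), of i t] strict_mono_on_less_eq[OF assms(2), of t j]
      c i j t assms(3) by auto
  then show "c \<in> e ` {a..<b}" using t i j by auto
qed

theorem theorem2p3:
  fixes M :: "'a measure" and S :: "'b measure"
    and X :: "nat set \<Rightarrow> 'a \<Rightarrow> 'b"
    and d l n :: nat and \<beta> :: real
  assumes "prob_space M"
    and "d \<ge> 1" and "2 * d \<le> l" and "l \<le> n"
    and "0 < \<beta>" and "\<beta> \<le> 1"
    and X_meas: "\<And>s. s \<in> subsets_of_card {1..n} d \<Longrightarrow> X s \<in> measurable M S"
    and "dissociated M S n d X \<beta> l"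
  shows "\<forall>p::real. 1 < p \<and> p \<le> 2 \<longrightarrow>
    (\<forall>f \<in> borel_measurable (PiM (subsets_of_card {1..n} d) (\<lambda>_. S)).
      integrable M (\<lambda>\<omega>. \<bar>f (restrict (\<lambda>s. X s \<omega>) (subsets_of_card {1..n} d))\<bar> powr p) \<longrightarrow>
      (\<forall>k. d \<le> k \<and> k \<le> l div 2 \<longrightarrow>
        (\<forall>I \<in> subsets_of_card {1..n} l.
          (\<exists>J \<in> subsets_of_card I k.
            (nat_interval I \<longrightarrow> nat_interval J) \<and>
            (\<forall>r::real. 1 \<le> r \<and> r < p \<longrightarrow>
              (let Y = (\<lambda>\<omega>. f (restrict (\<lambda>s. X s \<omega>) (subsets_of_card {1..n} d)));
                   EY = integral\<^sup>L M Y
               in Lnorm M r (\<lambda>\<omega>. real_cond_exp M (array_sigma M S d X J) Y \<omega> - EY)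
                  \<le> ((p - 1) powr (-1/2) * sqrt (2 * real k / real l)
                      + 10 * \<beta> powr (1/r - 1/p)) * Lnorm M p (\<lambda>\<omega>. Y \<omega> - EY)))))))"
proof (intro allI impI ballI, elim conjE)
  fix p :: real and f :: "(nat set \<Rightarrow> 'b) \<Rightarrow> real" and k :: nat and I :: "nat set"
  assume p: "1 < p" "p \<le> 2"
    and f: "f \<in> borel_measurable (PiM (subsets_of_card {1..n} d) (\<lambda>_. S))"
    and int: "integrable M (\<lambda>\<omega>. \<bar>f (restrict (\<lambda>s. X s \<omega>) (subsets_of_card {1..n} d))\<bar> powr p)"
    and I: "I \<in> subsets_of_card {1..n} l" and k: "d \<le> k" "k \<le> l div 2"
  interpret prob_space M by fact
  define Y where "Y = (\<lambda>\<omega>. f (restrict (\<lambda>s. X s \<omega>) (subsets_of_card {1..n} d)))"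
  \<comment> \<open>The target involves the norm of the centred variable, so the martingale argument
    is run on Z.\<close>
  define Z where "Z = (\<lambda>\<omega>. Y \<omega> - expectation Y)"
  have Y_Lp: "in_Lp M p Y"
    unfolding in_Lp_def Y_def
    using int measurable_compose[OF measurable_restrict f, of X M] X_meas by simp
  have Z_Lp: "in_Lp M p Z"
    unfolding Z_def using p by (intro in_Lp_diff[OF Y_Lp]) (auto simp: in_Lp_def)
  have intY: "integrable M Y" using in_Lp_imp_integrable[OF Y_Lp] p by simp
  have EZ: "expectation Z = 0" unfolding Z_def using intY by (simp add: prob_space)

  \<comment> \<open>Cutting I into consecutive blocks of size k\<close>
  have In: "I \<subseteq> {1..n}" and cardI: "card I = l" using I by (auto simp: subsets_of_card_def)
  then have "finite I" using finite_subset by blast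
  then obtain e where e: "bij_betw e {..<l} I" "strict_mono_on {..<l} e"
    using ex_bij_betw_strict_mono_card[of I] cardI by metis
  have eI: "I = e ` {..<l}" and inj: "inj_on e {..<l}" using e(1) by (auto simp: bij_betw_def)
  define m where "m = l div k"
  have k0: "0 < k" using k assms(2) by simp
  have lk: "2 * k \<le> l" using k(2) by simp
  have m0: "0 < m" unfolding m_def using lk k0 by (simp add: div_greater_zero_iff)
  have mk: "m * k \<le> l" unfolding m_def by simp
  have blk: "Suc i * k \<le> l" if "i < m" for i
    using that mk mult_le_mono1[of "Suc i" m k] by simp
  \<comment> \<open>The remainder of the division is less than k, and as m \<ge> 1 it is absorbed by
    doubling; this is the origin of the factor 2 under the root.\<close>
  have lm: "l \<le> 2 * m * k"
  proof -
    have "l = m * k + l mod k" unfolding m_def by simp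
    also have "\<dots> \<le> m * k + k" using k0 mod_less_divisor[of k l] by (simp add: less_imp_le)
    also have "\<dots> \<le> m * k + m * k" using m0 by simp
    finally show ?thesis by simp
  qed
  \<comment> \<open>\<open>H i\<close> collects the first i blocks and \<open>J i\<close> is the
    next one, counting from 0; in particular \<open>H 0\<close> is empty.\<close>
  define H where "H = (\<lambda>i. e ` {..<i * k})"
  define J where "J = (\<lambda>i. e ` {i * k..<Suc i * k})"
  have HI: "H i \<subseteq> I" if "i \<le> m" for i
    using le_trans[OF mult_le_mono1[OF that] mk] unfolding H_def eI by (intro image_mono) auto
  have JI: "J i \<subseteq> I" if "i < m" for i
    using blk[OF that] unfolding J_def eI by (intro image_mono) auto
  have HJ: "H i \<subseteq> H (Suc i)" "J i \<subseteq> H (Suc i)" for i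
    unfolding H_def J_def by (intro image_mono; auto)+
  have cardJ: "card (J i) = k" if "i < m" for i
    unfolding J_def using blk[OF that] by (subst card_image) (auto intro: inj_on_subset[OF inj])
  have cardH: "card (H i) = i * k" if "i < m" for i
    unfolding H_def using blk[OF that] by (subst card_image) (auto intro: inj_on_subset[OF inj])

  \<comment> \<open>Mixing between a block and its past\<close>
  define \<F> where "\<F> = array_sigma M S d X"
  have sub: "subalgebra M (\<F> A)" if "A \<subseteq> {1..n}" for A
    unfolding \<F>_def using that subsets_of_card_mono X_meas by (intro subalgebra_array_sigma) blast
  have mix: "mixing (\<F> (H i)) (\<F> (J i)) \<beta>" if "i < m" for i
  proof (cases "i = 0")
    case True
    then have "H i = {}" by (simp add: H_def)
    moreover have "subalgebra M (\<F> (J i))" using JI[OF that] In by (intro sub) auto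
    ultimately show ?thesis
      using mixing_array_sigma_empty[OF assms(2) less_imp_le[OF assms(5)]] by (simp add: \<F>_def)
  next
    case False
    have fin: "finite (H i)" "finite (J i)" by (simp_all add: H_def J_def)
    have ne: "H i \<noteq> {}" "J i \<noteq> {}" using False k0 by (auto simp: H_def J_def lessThan_empty_iff)
    have "Max (H i) < Min (J i)"
    proof -
      have "a < b" if ab: "a \<in> H i" "b \<in> J i" for a b
      proof -
        obtain s t where "a = e s" "s < i * k" "b = e t" "i * k \<le> t" "t < Suc i * k"
          using ab by (auto simp: H_def J_def)
        then show ?thesis using strict_mono_onD[OF e(2), of s t] blk[OF \<open>i < m\<close>] by simp
      qed
      then show ?thesis using fin ne by simp
    qed
    \<comment> \<open>A nonempty past contains a full block, so it meets the lower size bound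
      d.\<close>
    moreover have "k \<le> i * k" using False by simp
    then have "d \<le> card (H i)" "d \<le> card (J i)"
      unfolding cardH[OF that] cardJ[OF that] using k(1) by linarith+
    moreover have "card (H i) + card (J i) \<le> l" using cardH[OF that] cardJ[OF that] blk[OF that] by simp
    moreover have "H i \<subseteq> {1..n}" "J i \<subseteq> {1..n}" using HI[of i] JI[of i] that In by auto
    ultimately show ?thesis
      using assms(8) ne unfolding dissociated_def mixing_def \<F>_def by blast
  qed
  have subH: "subalgebra M (\<F> (H i))" if "i \<le> m" for i
    using HI[OF that] In by (intro sub) auto
  \<comment> \<open>The block is selected by an L_p norm only, so the same J serves every r.\<close>
  obtain i where i: "i < m" and small:
    "Lnorm M p (\<lambda>x. real_cond_exp M (\<F> (H (Suc i))) Z x - real_cond_exp M (\<F> (H i)) Z x)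
      \<le> (p - 1) powr (-1/2) * sqrt (1 / real m) * Lnorm M p Z"
    using ex_small_martingale_difference[OF Z_Lp p m0, of "\<lambda>i. \<F> (H i)"] subH
      subalgebra_array_sigma_mono[OF HJ(1)] unfolding \<F>_def by blast
  have subJ: "subalgebra M (\<F> (J i))" using JI[OF i] In by (intro sub) auto
  interpret J: sigma_finite_subalgebra M "\<F> (J i)" by (rule sigma_finite_subalgebraI[OF subJ])
  have rate: "sqrt (1 / real m) \<le> sqrt (2 * real k / real l)"
  proof -
    have "real l \<le> 2 * real m * real k" using lm by (metis of_nat_le_iff of_nat_mult of_nat_numeral)
    then show ?thesis using m0 lk k0 by (simp add: field_simps)
  qed
  \<comment> \<open>Centring changes the conditional expectation and the mean by the same constant,
    almost everywhere.\<close>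
  have center: "AE x in M. real_cond_exp M (\<F> (J i)) Y x - expectation Y = real_cond_exp M (\<F> (J i)) Z x - expectation Z"
  proof -
    have const: "integrable M (\<lambda>_. expectation Y)" by simp
    show ?thesis
      using J.real_cond_exp_diff[OF intY const] J.real_cond_exp_F_meas[OF const borel_measurable_const]
      unfolding EZ unfolding Z_def by eventually_elim simp
  qed
  have bound: "Lnorm M r (\<lambda>x. real_cond_exp M (\<F> (J i)) Y x - expectation Y)
      \<le> ((p - 1) powr (-1/2) * sqrt (2 * real k / real l) + 10 * \<beta> powr (1/r - 1/p)) * Lnorm M p Z"
    if r: "1 \<le> r" "r < p" for r
  proof -
    have "Lnorm M r (\<lambda>x. real_cond_exp M (\<F> (J i)) Y x - expectation Y)
        = Lnorm M r (\<lambda>x. real_cond_exp M (\<F> (J i)) Z x - expectation Z)"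
      using center by (intro Lnorm_cong_AE) auto
    also have "\<dots> \<le> Lnorm M p (\<lambda>x. real_cond_exp M (\<F> (H (Suc i))) Z x - real_cond_exp M (\<F> (H i)) Z x)
        + 6 * \<beta> powr (1 / r - 1 / p) * Lnorm M p Z"
      using subalgebra_array_sigma_mono[OF HJ(1)] subalgebra_array_sigma_mono[OF HJ(2)] subH[of "Suc i"] i
      by (intro cond_exp_le_martingale_difference Z_Lp r assms(5) mix) (auto simp: \<F>_def)
    \<comment> \<open>The martingale term takes the rate 2k/l, and the mixing constant 6 is relaxed
      to 10.\<close>
    also have "\<dots> \<le> (p - 1) powr (-1/2) * sqrt (2 * real k / real l) * Lnorm M p Z
        + 10 * \<beta> powr (1 / r - 1 / p) * Lnorm M p Z"
    proof (rule add_mono)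
      have "(p - 1) powr (-1/2) * sqrt (1 / real m) * Lnorm M p Z
          \<le> (p - 1) powr (-1/2) * sqrt (2 * real k / real l) * Lnorm M p Z"
        by (intro mult_left_mono mult_right_mono rate) auto
      with small show "Lnorm M p (\<lambda>x. real_cond_exp M (\<F> (H (Suc i))) Z x - real_cond_exp M (\<F> (H i)) Z x)
          \<le> (p - 1) powr (-1/2) * sqrt (2 * real k / real l) * Lnorm M p Z" by linarith
    qed (auto intro!: mult_right_mono)
    finally show ?thesis by (simp add: distrib_right)
  qed
  show "\<exists>J \<in> subsets_of_card I k.
      (nat_interval I \<longrightarrow> nat_interval J) \<and>
      (\<forall>r::real. 1 \<le> r \<and> r < p \<longrightarrow>
        (let Y = (\<lambda>\<omega>. f (restrict (\<lambda>s. X s \<omega>) (subsets_of_card {1..n} d)));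
             EY = integral\<^sup>L M Y
         in Lnorm M r (\<lambda>\<omega>. real_cond_exp M (array_sigma M S d X J) Y \<omega> - EY)
            \<le> ((p - 1) powr (-1/2) * sqrt (2 * real k / real l)
                + 10 * \<beta> powr (1/r - 1/p)) * Lnorm M p (\<lambda>\<omega>. Y \<omega> - EY)))"
  proof (rule bexI[of _ "J i"], intro conjI impI allI)
    show "J i \<in> subsets_of_card I k"
      using JI[OF i] cardJ[OF i] by (simp add: subsets_of_card_def)
    show "nat_interval (J i)" if "nat_interval I"
      using nat_interval_strict_mono_image[OF _ e(2) blk[OF i]] that unfolding J_def eI by blast
    show "let Y = (\<lambda>\<omega>. f (restrict (\<lambda>s. X s \<omega>) (subsets_of_card {1..n} d)));
             EY = integral\<^sup>L M Y
         in Lnorm M r (\<lambda>\<omega>. real_cond_exp M (array_sigma M S d X (J i)) Y \<omega> - EY)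
            \<le> ((p - 1) powr (-1/2) * sqrt (2 * real k / real l)
                + 10 * \<beta> powr (1/r - 1/p)) * Lnorm M p (\<lambda>\<omega>. Y \<omega> - EY)"
      if "1 \<le> r \<and> r < p" for r
      using bound[of r] that unfolding Let_def Y_def[symmetric] Z_def \<F>_def by simp
  qed
qed

end
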